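(* Let $(W,S)$ be a finite Coxeter system and $I\subset S$. Then: (1) $|W(I,\emptyset,b)|=|W(\emptyset,I,b^{-1})|=|W_I|$ for all $b\in X_{I\emptyset}$; (2) $X_{IS}=\{e\}$ and $W(I,S,e)=W(S,I,e)=X_I$.
   Context: $\ell$ is the length function and $e$ the identity of $W$. For $I\subset S$, $W_I$ is the subgroup generated by $I$ and $X_I=\{w\in W:\ell(ws)>\ell(w)\ \forall s\in I\}$. Every $w\in W$ factors uniquely as $w=w^Iw_I$ with $w^I\in X_I$, $w_I\in W_I$. For $I,J\subset S$, $X_{IJ}=X_I^{-1}\cap X_J$ with $X_I^{-1}=\{x^{-1}:x\in X_I\}$. For $b\in X_{IJ}$, $$W(I,J,b)=\{w\in W: w^Jb^{-1}=(wb^{-1})_I\}.$$ *)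

theory Defs
  imports "HOL-Algebra.Generated_Groups"
begin

text \<open>The letter \<open>(s, True)\<close> stands for \<open>s\<close> and \<open>(s, False)\<close> for its formal inverse, so that group
  words over \<open>S\<close> are the elements of \<open>lists (S \<times> UNIV)\<close>.\<close>

type_synonym 'a gword = "('a \<times> bool) list"

definition gword_eval :: "('a, 'b) monoid_scheme \<Rightarrow> 'a gword \<Rightarrow> 'a" where
  "gword_eval G u = foldr (\<lambda>(s, p) g. (if p then s else inv\<^bsub>G\<^esub> s) \<otimes>\<^bsub>G\<^esub> g) u \<one>\<^bsub>G\<^esub>"

text \<open>The classes of group words over \<open>S\<close> modulo \<open>pres_eq S R\<close> are the elements of the quotient of
  the free group on \<open>S\<close> by the normal closure of \<open>R\<close>.\<close>

inductive pres_eq :: "'a set \<Rightarrow> 'a gword set \<Rightarrow> 'a gword \<Rightarrow> 'a gword \<Rightarrow> bool"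
  for S :: "'a set" and R :: "'a gword set" where
  refl: "pres_eq S R u u"
| sym: "pres_eq S R u v \<Longrightarrow> pres_eq S R v u"
| trans: "pres_eq S R u v \<Longrightarrow> pres_eq S R v w \<Longrightarrow> pres_eq S R u w"
| cancel: "s \<in> S \<Longrightarrow> pres_eq S R (u @ [(s, p), (s, \<not> p)] @ v) (u @ v)"
| relator: "r \<in> R \<Longrightarrow> pres_eq S R (u @ r @ v) (u @ v)"

definition has_presentation :: "('a, 'b) monoid_scheme \<Rightarrow> 'a set \<Rightarrow> 'a gword set \<Rightarrow> bool" where
  "has_presentation G S R \<longleftrightarrow>
     group G \<and> S \<subseteq> carrier G \<and> R \<subseteq> lists (S \<times> UNIV) \<and> generate G S = carrier G \<and>
     (\<forall>u \<in> lists (S \<times> UNIV). gword_eval G u = \<one>\<^bsub>G\<^esub> \<longleftrightarrow> pres_eq S R u [])"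

text \<open>The value \<open>0\<close> encodes an infinite entry: the corresponding relator is then the empty word.\<close>

definition coxeter_matrix :: "'a set \<Rightarrow> ('a \<Rightarrow> 'a \<Rightarrow> nat) \<Rightarrow> bool" where
  "coxeter_matrix S m \<longleftrightarrow> (\<forall>s\<in>S. \<forall>t\<in>S. m s t = m t s \<and> (m s t = 1 \<longleftrightarrow> s = t))"

definition coxeter_relators :: "'a set \<Rightarrow> ('a \<Rightarrow> 'a \<Rightarrow> nat) \<Rightarrow> 'a gword set" where
  "coxeter_relators S m =
     {concat (replicate (m s t) [(s, True), (t, True)]) | s t. s \<in> S \<and> t \<in> S}"

definition coxeter_system :: "('a, 'b) monoid_scheme \<Rightarrow> 'a set \<Rightarrow> bool" where
  "coxeter_system W S \<longleftrightarrow>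
     (\<exists>m. coxeter_matrix S m \<and> has_presentation W S (coxeter_relators S m))"

text \<open>Since the elements of \<open>S\<close> are involutions, words without formal inverses suffice here.\<close>

definition cox_length :: "('a, 'b) monoid_scheme \<Rightarrow> 'a set \<Rightarrow> 'a \<Rightarrow> nat" where
  "cox_length W S w =
     (LEAST n. \<exists>ss \<in> lists S. length ss = n \<and> foldr (\<otimes>\<^bsub>W\<^esub>) ss \<one>\<^bsub>W\<^esub> = w)"

abbreviation parabolic :: "('a, 'b) monoid_scheme \<Rightarrow> 'a set \<Rightarrow> 'a set" where
  "parabolic W I \<equiv> generate W I"

definition min_reps :: "('a, 'b) monoid_scheme \<Rightarrow> 'a set \<Rightarrow> 'a set \<Rightarrow> 'a set" where
  "min_reps W S I =
     {w \<in> carrier W. \<forall>s\<in>I. cox_length W S (w \<otimes>\<^bsub>W\<^esub> s) > cox_length W S w}"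

text \<open>\<open>upper_part W S I w\<close> and \<open>lower_part W S I w\<close> are \<open>w\<^sup>I\<close> and \<open>w\<^sub>I\<close>, the two factors in the
  unique factorization of \<open>w\<close> as an element of \<open>X\<^sub>I\<close> times an element of \<open>W\<^sub>I\<close>.\<close>

definition upper_part :: "('a, 'b) monoid_scheme \<Rightarrow> 'a set \<Rightarrow> 'a set \<Rightarrow> 'a \<Rightarrow> 'a" where
  "upper_part W S I w =
     (THE x. x \<in> min_reps W S I \<and> (\<exists>y \<in> parabolic W I. w = x \<otimes>\<^bsub>W\<^esub> y))"

definition lower_part :: "('a, 'b) monoid_scheme \<Rightarrow> 'a set \<Rightarrow> 'a set \<Rightarrow> 'a \<Rightarrow> 'a" where
  "lower_part W S I w =
     (THE y. y \<in> parabolic W I \<and> (\<exists>x \<in> min_reps W S I. w = x \<otimes>\<^bsub>W\<^esub> y))"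

definition double_reps :: "('a, 'b) monoid_scheme \<Rightarrow> 'a set \<Rightarrow> 'a set \<Rightarrow> 'a set \<Rightarrow> 'a set" where
  "double_reps W S I J = (\<lambda>x. inv\<^bsub>W\<^esub> x) ` min_reps W S I \<inter> min_reps W S J"

definition W_set :: "('a, 'b) monoid_scheme \<Rightarrow> 'a set \<Rightarrow> 'a set \<Rightarrow> 'a set \<Rightarrow> 'a \<Rightarrow> 'a set" where
  "W_set W S I J b =
     {w \<in> carrier W. upper_part W S J w \<otimes>\<^bsub>W\<^esub> inv\<^bsub>W\<^esub> b = lower_part W S I (w \<otimes>\<^bsub>W\<^esub> inv\<^bsub>W\<^esub> b)}"

end

theory Submission
  imports Defs
begin

text \<open>In each of the sets \<open>W(I, J, b)\<close> in question, \<open>I\<close> or \<open>J\<close> is empty or all of \<open>S\<close>, where the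
  factorization is degenerate: it is \<open>w = w e\<close> along the empty set, because no condition is imposed
  on its minimal representatives, and \<open>w = e w\<close> along \<open>S\<close>, because \<open>X\<^sub>S = {e}\<close>.  Substituting this
  into the defining equation gives \<open>W(I, {}, b) = W\<^sub>I b\<close>, \<open>W({}, I, b\<inverse>) = b\<inverse> W\<^sub>I\<close> and
  \<open>W(I, S, e) = W(S, I, e) = X\<^sub>I\<close>.

  The substance is the uniqueness of the factorization (\<open>min_reps_factorization\<close>), which has to be
  derived from the presentation.  A word \<open>s\<^sub>1 \<dots> s\<^sub>k\<close> has an associated list of reflections
  \<open>r\<^sub>i = s\<^sub>k \<dots> s\<^sub>i\<^sub>+\<^sub>1 s\<^sub>i s\<^sub>i\<^sub>+\<^sub>1 \<dots> s\<^sub>k\<close>; multiplying the word by \<open>r\<^sub>i\<close> from the right deletes its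
  \<open>i\<close>-th letter (\<open>deletion\<close>).  How often a given element occurs in this list depends on the word,
  but the parity depends only on the group element that the word represents
  (\<open>refls_parity_cong\<close>), since the relators \<open>s s\<close> and \<open>(s t)\<^sup>m\<close> list each reflection an even
  number of times.  So an element occurring an odd number of times in the list of one word for
  \<open>w\<close> occurs in the list of a shortest word for \<open>w\<close>, and right multiplication by it shortens \<open>w\<close>.

  Now let \<open>x\<close> have minimal length in its coset \<open>x W\<^sub>I\<close>, and let \<open>y \<noteq> e\<close> have a shortest word in
  \<open>I\<close> ending in \<open>s\<close>.  In the list of a word for \<open>x y\<close>, the letters of \<open>y\<close> contribute \<open>s\<close> exactly
  once, and the letters of \<open>x\<close> contribute it an even number of times, since otherwise \<open>x\<close> could be
  shortened within its coset.  Hence \<open>x y s\<close> is shorter than \<open>x y\<close>, and \<open>x y\<close> is not in \<open>X\<^sub>I\<close>: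
  every coset contains exactly one element of \<open>X\<^sub>I\<close>.\<close>

section \<open>Words and their reflections\<close>

locale coxeter_group = group W for W :: "('a, 'b) monoid_scheme" (structure) +
  fixes S :: "'a set" and m :: "'a \<Rightarrow> 'a \<Rightarrow> nat"
  assumes matrix: "coxeter_matrix S m"
    and presentation: "has_presentation W S (coxeter_relators S m)"
begin

abbreviation wprod :: "'a list \<Rightarrow> 'a" where
  "wprod u \<equiv> foldr (\<otimes>) u \<one>"

primrec refls :: "'a list \<Rightarrow> 'a list" where
  "refls [] = []"
| "refls (s # u) = (inv (wprod u) \<otimes> s \<otimes> wprod u) # refls u"

lemma gens_closed [simp]: "s \<in> S \<Longrightarrow> s \<in> carrier W"
  using presentation by (auto simp: has_presentation_def)

lemma wprod_closed [simp]: "u \<in> lists S \<Longrightarrow> wprod u \<in> carrier W"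
  by (induction u) auto

\<comment> \<open>This rule would rewrite the product of a concatenation to a fold that is not a product.\<close>
declare foldr_append [simp del]

lemma rev_in_lists [simp]: "rev u \<in> lists A \<longleftrightarrow> u \<in> lists A"
  by (simp add: in_lists_conv_set)

lemma inv_cancel_left [simp]:
  assumes "g \<in> carrier W" "h \<in> carrier W"
  shows "inv g \<otimes> (g \<otimes> h) = h" and "g \<otimes> (inv g \<otimes> h) = h"
  using assms by (simp_all flip: m_assoc)

lemma wprod_append:
  "u \<in> lists S \<Longrightarrow> v \<in> lists S \<Longrightarrow> wprod (u @ v) = wprod u \<otimes> wprod v"
  by (induction u) (auto simp: m_assoc)

lemma refls_closed: "u \<in> lists S \<Longrightarrow> set (refls u) \<subseteq> carrier W"
  by (induction u) auto

lemma gword_eval_positive: "gword_eval W (map (\<lambda>s. (s, True)) u) = wprod u"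
  by (induction u) (auto simp: gword_eval_def)

lemma wprod_eq_one_iff_pres:
  assumes "u \<in> lists S"
  shows "wprod u = \<one> \<longleftrightarrow> pres_eq S (coxeter_relators S m) (map (\<lambda>s. (s, True)) u) []"
proof -
  have "map (\<lambda>s. (s, True)) u \<in> lists (S \<times> UNIV)"
    using assms by auto
  then show ?thesis
    using presentation by (metis has_presentation_def gword_eval_positive)
qed

lemma wprod_relator:
  assumes "s \<in> S" "t \<in> S"
  shows "wprod (concat (replicate (m s t) [s, t])) = \<one>"
proof -
  let ?r = "concat (replicate (m s t) [s, t])"
  have r: "map (\<lambda>s. (s, True)) ?r = concat (replicate (m s t) [(s, True), (t, True)])"
    by (simp add: map_concat)
  have "map (\<lambda>s. (s, True)) ?r \<in> coxeter_relators S m"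
    using assms unfolding r coxeter_relators_def by blast
  from pres_eq.relator[OF this, of S "[]" "[]"] show ?thesis
    using assms by (subst wprod_eq_one_iff_pres) (auto split: if_splits)
qed

lemma gens_involution [simp]:
  assumes "s \<in> S"
  shows "s \<otimes> s = \<one>"
proof -
  have "m s s = 1"
    using matrix assms unfolding coxeter_matrix_def by blast
  then show ?thesis
    using wprod_relator[of s s] assms by simp
qed

lemma gens_involution_left [simp]: "s \<in> S \<Longrightarrow> g \<in> carrier W \<Longrightarrow> s \<otimes> (s \<otimes> g) = g"
  by (metis gens_closed gens_involution l_one m_assoc)

lemma gens_inv [simp]: "s \<in> S \<Longrightarrow> inv s = s"
  by (simp add: inv_equality)

lemma wprod_rev: "u \<in> lists S \<Longrightarrow> wprod (rev u) = inv (wprod u)"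
proof (induction u)
  case (Cons s u)
  then have "s \<in> S" "u \<in> lists S" by auto
  with Cons.IH show ?case
    by (simp add: wprod_append inv_mult_group)
qed simp

lemma parabolic_word:
  assumes "I \<subseteq> S" "y \<in> parabolic W I"
  obtains u where "u \<in> lists I" "wprod u = y"
proof -
  from assms(2) have "\<exists>u\<in>lists I. wprod u = y"
  proof induction
    case one
    show ?case by (rule bexI[of _ "[]"]) auto
  next
    case (incl h)
    then have "h \<in> S" using assms(1) by blast
    with incl show ?case by (intro bexI[of _ "[h]"]) simp_all
  next
    case (inv h)
    then have "h \<in> S" using assms(1) by blast
    with inv show ?case by (intro bexI[of _ "[h]"]) simp_all
  next
    case (eng h1 h2)
    then obtain u v where "u \<in> lists I" "v \<in> lists I" "wprod u = h1" "wprod v = h2"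
      by blast
    moreover from this have "u \<in> lists S" "v \<in> lists S"
      using assms(1) by auto
    ultimately show ?case
      by (intro bexI[of _ "u @ v"]) (simp_all add: wprod_append)
  qed
  then show ?thesis using that by blast
qed

lemma parabolic_closed: "I \<subseteq> S \<Longrightarrow> y \<in> parabolic W I \<Longrightarrow> y \<in> carrier W"
  using generate_in_carrier[of I y] gens_closed by blast

lemma parabolic_S: "parabolic W S = carrier W"
  using presentation by (simp add: has_presentation_def)

lemma parabolic_subgroup: "I \<subseteq> S \<Longrightarrow> subgroup (parabolic W I) W"
  by (rule generate_is_subgroup) auto

text \<open>Multiplication by the \<open>i\<close>-th reflection cancels everything to the right of the \<open>i\<close>-th letter,
  then that letter, and restores the rest.  Keeping track of the alphabet allows the same
  argument inside a parabolic subgroup.\<close>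

lemma deletion:
  assumes "A \<subseteq> S" "u \<in> lists A" "t \<in> set (refls u)"
  obtains v where "v \<in> lists A" "length u = Suc (length v)" "wprod v = wprod u \<otimes> t"
proof -
  from assms(2,3) have "\<exists>v\<in>lists A. length u = Suc (length v) \<and> wprod v = wprod u \<otimes> t"
  proof (induction u)
    case Nil
    then show ?case by simp
  next
    case (Cons s u)
    have S: "s \<in> S" "u \<in> lists S"
      using Cons.hyps assms(1) by auto
    consider "t = inv (wprod u) \<otimes> s \<otimes> wprod u" | "t \<in> set (refls u)"
      using Cons.prems by auto
    then show ?case
    proof cases
      case 1
      have "wprod (s # u) \<otimes> t = s \<otimes> (wprod u \<otimes> inv (wprod u)) \<otimes> s \<otimes> wprod u"
        using S unfolding 1 by (simp add: m_assoc del: r_inv)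
      also have "\<dots> = wprod u"
        using S by (simp add: m_assoc)
      finally show ?thesis
        using Cons.hyps by (intro bexI[of _ u]) auto
    next
      case 2
      from Cons.IH[OF 2] obtain v where v: "v \<in> lists A" "length u = Suc (length v)"
        "wprod v = wprod u \<otimes> t" by blast
      have "t \<in> carrier W"
        using refls_closed[OF S(2)] 2 by blast
      with v Cons.hyps S show ?thesis
        by (intro bexI[of _ "s # v"]) (auto simp: m_assoc)
    qed
  qed
  then show ?thesis using that by blast
qed

section \<open>The parity of a reflection is well defined\<close>

lemma conj_eq_iff:
  assumes "a \<in> carrier W" "t \<in> carrier W" "g \<in> carrier W"
  shows "inv g \<otimes> a \<otimes> g = t \<longleftrightarrow> a = g \<otimes> t \<otimes> inv g"
  using assms by (metis inv_closed inv_solve_left inv_solve_right m_assoc m_closed)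

lemma count_refls_append:
  assumes "u \<in> lists S" "v \<in> lists S" "t \<in> carrier W"
  shows "count_list (refls (u @ v)) t =
    count_list (refls u) (wprod v \<otimes> t \<otimes> inv (wprod v)) + count_list (refls v) t"
  using assms(1)
proof (induction u)
  case Nil
  then show ?case by simp
next
  case (Cons s u)
  have c: "s \<in> carrier W" "wprod u \<in> carrier W" "wprod v \<in> carrier W"
    using Cons.hyps assms(2) by auto
  have "inv (wprod (u @ v)) \<otimes> s \<otimes> wprod (u @ v) =
      inv (wprod v) \<otimes> (inv (wprod u) \<otimes> s \<otimes> wprod u) \<otimes> wprod v"
    using Cons.hyps c assms(2)
    by (simp add: wprod_append inv_mult_group m_assoc)
  with Cons.IH conj_eq_iff[of "inv (wprod u) \<otimes> s \<otimes> wprod u" t "wprod v"] c assms(3)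
  show ?case by auto
qed

text \<open>In the dihedral group generated by \<open>s\<close> and \<open>t\<close>, conjugation by \<open>t\<close> inverts the rotation
  \<open>s t\<close>, so the reflections of \<open>(s t)\<^sup>k\<close> are \<open>t\<close> times the successive powers of that rotation.\<close>

lemma refls_alternating:
  assumes "s \<in> S" "t \<in> S"
  shows "wprod (concat (replicate k [s, t])) = (s \<otimes> t) [^] k"
    and "refls (concat (replicate k [s, t])) =
      rev (map (\<lambda>i. t \<otimes> (s \<otimes> t) [^] i) [0..<2 * k])"
proof -
  define c where "c = s \<otimes> t"
  have c [simp]: "c \<in> carrier W" using assms by (simp add: c_def)
  have comm: "c \<otimes> c [^] k = c [^] k \<otimes> c" for k :: nat
    using c by (metis nat_pow_Suc nat_pow_Suc2)
  have flip: "inv (c [^] k) \<otimes> t = t \<otimes> c [^] k" for k :: nat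
  proof (induction k)
    case 0
    then show ?case using assms by simp
  next
    case (Suc k)
    have "inv (c [^] Suc k) \<otimes> t = inv c \<otimes> (inv (c [^] k) \<otimes> t)"
      using assms by (simp add: inv_mult_group m_assoc)
    also have "\<dots> = (inv c \<otimes> t) \<otimes> c [^] k"
      using assms by (simp add: Suc.IH m_assoc)
    also have "inv c \<otimes> t = t \<otimes> c"
      using assms by (simp add: c_def inv_mult_group m_assoc)
    also have "t \<otimes> c \<otimes> c [^] k = t \<otimes> c [^] Suc k"
      using assms by (simp add: m_assoc comm)
    finally show ?case .
  qed
  show w: "wprod (concat (replicate k [s, t])) = (s \<otimes> t) [^] k" for k
  proof (induction k)
    case (Suc k)
    then show ?case
      using assms comm[of k] by (simp add: c_def flip: m_assoc)
  qed simp
  show "refls (concat (replicate k [s, t])) =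
      rev (map (\<lambda>i. t \<otimes> (s \<otimes> t) [^] i) [0..<2 * k])"
  proof (induction k)
    case 0
    then show ?case by simp
  next
    case (Suc k)
    have 1: "inv (c [^] k) \<otimes> t \<otimes> c [^] k = t \<otimes> c [^] (2 * k)"
      unfolding flip using assms by (simp add: m_assoc nat_pow_mult mult_2)
    have "inv (t \<otimes> c [^] k) \<otimes> s \<otimes> (t \<otimes> c [^] k) = inv (c [^] k) \<otimes> t \<otimes> (c \<otimes> c [^] k)"
      using assms by (simp add: c_def inv_mult_group m_assoc)
    also have "\<dots> = t \<otimes> c [^] k \<otimes> c [^] Suc k"
      by (simp add: flip comm)
    also have "\<dots> = t \<otimes> c [^] (Suc (2 * k))"
      using assms nat_pow_mult[of c k "Suc k"] by (simp add: m_assoc mult_2)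
    finally have 2: "inv (t \<otimes> c [^] k) \<otimes> s \<otimes> (t \<otimes> c [^] k) = t \<otimes> c [^] (Suc (2 * k))" .
    show ?case
      using Suc.IH 1 2 by (simp add: w flip: c_def)
  qed
qed

text \<open>As \<open>(s t)\<^sup>k = e\<close>, the powers of \<open>s t\<close> run twice through the same list of \<open>k\<close> elements.\<close>

lemma even_count_refls_dihedral:
  assumes "s \<in> S" "t \<in> S" "wprod (concat (replicate k [s, t])) = \<one>"
  shows "even (count_list (refls (concat (replicate k [s, t]))) x)"
proof -
  define f where "f i = t \<otimes> (s \<otimes> t) [^] i" for i :: nat
  have "(s \<otimes> t) [^] k = \<one>"
    using assms by (simp add: refls_alternating)
  then have period: "f (i + k) = f i" for i
    using assms(1,2) by (simp add: f_def flip: nat_pow_mult)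
  have "[0..<2 * k] = [0..<k] @ map (\<lambda>i. i + k) [0..<k]"
    using upt_add_eq_append[of 0 k k] by (simp add: map_add_upt mult_2)
  then have "map f [0..<2 * k] = map f [0..<k] @ map f [0..<k]"
    by (simp add: comp_def period)
  then show ?thesis
    using assms(1,2) by (simp add: refls_alternating flip: f_def)
qed

lemma insert_even_word:
  assumes "u \<in> lists S" "v \<in> lists S" "r \<in> lists S" "wprod r = \<one>"
    and "\<And>x. even (count_list (refls r) x)" and "t \<in> carrier W"
  shows "even (count_list (refls (u @ r @ v)) t) = even (count_list (refls (u @ v)) t)"
  using assms by (simp add: count_refls_append wprod_append)

lemma map_fst_in_lists: "u \<in> lists (A \<times> B) \<Longrightarrow> map fst u \<in> lists A"
  by (induction u) auto

text \<open>The relation \<open>pres_eq\<close> may pass through letters outside \<open>S\<close>, on which nothing is known;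
  carrying the equivalence of the two memberships through the induction excludes them.  Forgetting
  the exponents of the letters is harmless because the generators are involutions.\<close>

lemma pres_eq_parity:
  assumes "pres_eq S (coxeter_relators S m) u v"
  shows "(u \<in> lists (S \<times> UNIV) \<longleftrightarrow> v \<in> lists (S \<times> UNIV)) \<and>
    (u \<in> lists (S \<times> UNIV) \<longrightarrow> (\<forall>t\<in>carrier W.
      even (count_list (refls (map fst u)) t) = even (count_list (refls (map fst v)) t)))"
  using assms
proof induction
  case (cancel s u p v)
  have "even (count_list (refls (map fst (u @ [(s, p), (s, \<not> p)] @ v))) t) =
      even (count_list (refls (map fst (u @ v))) t)"
    if "u \<in> lists (S \<times> UNIV)" "v \<in> lists (S \<times> UNIV)" "t \<in> carrier W" for t
  proof -
    have uv: "map fst u \<in> lists S" "map fst v \<in> lists S"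
      by (fact that(1,2)[THEN map_fst_in_lists])+
    show ?thesis
      using insert_even_word[OF uv, of "[s, s]" t] cancel that by simp
  qed
  with cancel show ?case by auto
next
  case (relator r u v)
  then obtain s t where st: "s \<in> S" "t \<in> S"
    and r: "r = concat (replicate (m s t) [(s, True), (t, True)])"
    by (auto simp: coxeter_relators_def)
  have r': "map fst r = concat (replicate (m s t) [s, t])"
    by (simp add: r map_concat)
  have rS: "r \<in> lists (S \<times> UNIV)"
    using st by (auto simp: r split: if_splits)
  have "even (count_list (refls (map fst (u @ r @ v))) x) =
      even (count_list (refls (map fst (u @ v))) x)"
    if "u \<in> lists (S \<times> UNIV)" "v \<in> lists (S \<times> UNIV)" "x \<in> carrier W" for x
  proof -
    have uv: "map fst u \<in> lists S" "map fst v \<in> lists S"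
      by (fact that(1,2)[THEN map_fst_in_lists])+
    show ?thesis
      using insert_even_word[OF uv map_fst_in_lists[OF rS] _ _ that(3)] wprod_relator[OF st]
        even_count_refls_dihedral[OF st wprod_relator[OF st]]
      by (simp add: r')
  qed
  with rS show ?case by auto
qed auto

lemma even_count_refls_one:
  assumes "u \<in> lists S" "wprod u = \<one>" "t \<in> carrier W"
  shows "even (count_list (refls u) t)"
proof -
  have "map (\<lambda>s. (s, True)) u \<in> lists (S \<times> UNIV)"
    using assms(1) by auto
  then show ?thesis
    using pres_eq_parity[OF wprod_eq_one_iff_pres[OF assms(1), THEN iffD1, OF assms(2)]] assms(3)
    by (simp add: comp_def)
qed

text \<open>If \<open>u\<close> and \<open>v\<close> represent the same element, then \<open>u\<close> and \<open>v\<close> followed by the reverse of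
  \<open>v\<close> both represent \<open>e\<close>, and the reverse of \<open>v\<close> contributes the same to both.\<close>

lemma refls_parity_cong:
  assumes "u \<in> lists S" "v \<in> lists S" "wprod u = wprod v" "t \<in> carrier W"
  shows "even (count_list (refls u) t) = even (count_list (refls v) t)"
proof -
  let ?g = "wprod v" and ?r = "rev v"
  have g: "?g \<in> carrier W" and r: "?r \<in> lists S"
    using assms by auto
  \<comment> \<open>Conjugating back by the reverse of \<open>v\<close> recovers \<open>t\<close>.\<close>
  define t' where "t' = ?g \<otimes> t \<otimes> inv ?g"
  have t': "t' \<in> carrier W"
    using g assms by (simp add: t'_def)
  have "inv ?g \<otimes> t' \<otimes> ?g = t"
    using conj_eq_iff[OF t' assms(4) g] by (simp add: t'_def)
  then have t: "wprod ?r \<otimes> t' \<otimes> inv (wprod ?r) = t"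
    using g assms(2) by (simp add: wprod_rev)
  have "even (count_list (refls (w @ ?r)) t')" if "w \<in> lists S" "wprod w = ?g" for w
    using that g r t' assms(2)
    by (intro even_count_refls_one) (auto simp: wprod_append wprod_rev)
  from this[OF assms(1,3)] this[OF assms(2) HOL.refl] show ?thesis
    using assms(1,2) r t' by (simp add: count_refls_append t)
qed

section \<open>Length\<close>

lemma cox_length_le: "u \<in> lists S \<Longrightarrow> cox_length W S (wprod u) \<le> length u"
  unfolding cox_length_def by (rule Least_le) auto

lemma reduced_word:
  assumes "w \<in> carrier W"
  obtains u where "u \<in> lists S" "wprod u = w" "length u = cox_length W S w"
proof -
  obtain u where "u \<in> lists S" "wprod u = w"
    using parabolic_word[of S w] assms parabolic_S by auto
  then have "\<exists>n. \<exists>ss\<in>lists S. length ss = n \<and> wprod ss = w"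
    by blast
  from LeastI_ex[OF this] show ?thesis
    using that unfolding cox_length_def by blast
qed

text \<open>By parity, \<open>t\<close> also occurs among the reflections of a shortest word for the same element,
  where deletion makes the length drop.\<close>

lemma odd_refls_shortens:
  assumes "u \<in> lists S" "t \<in> carrier W" "odd (count_list (refls u) t)"
  shows "cox_length W S (wprod u \<otimes> t) < cox_length W S (wprod u)"
proof -
  obtain v where v: "v \<in> lists S" "wprod v = wprod u" "length v = cox_length W S (wprod u)"
    using reduced_word assms(1) by (metis wprod_closed)
  have "odd (count_list (refls v) t)"
    using refls_parity_cong[OF v(1) assms(1) v(2) assms(2)] assms(3) by simp
  then have "t \<in> set (refls v)"
    by (metis count_notin even_zero)
  from deletion[OF subset_refl v(1) this] obtain v' where
    "v' \<in> lists S" "length v = Suc (length v')" "wprod v' = wprod v \<otimes> t" .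
  with cox_length_le[of v'] v show ?thesis by simp
qed

text \<open>Appending \<open>s\<close> changes the parity of \<open>s\<close>, so \<open>s\<close> is odd for exactly one of \<open>w\<close> and
  \<open>w s\<close>, and that one is the longer.\<close>

lemma cox_length_mult_gen_neq:
  assumes "w \<in> carrier W" "s \<in> S"
  shows "cox_length W S (w \<otimes> s) \<noteq> cox_length W S w"
proof -
  obtain u where u: "u \<in> lists S" "wprod u = w"
    using reduced_word[OF assms(1)] by metis
  have us: "u @ [s] \<in> lists S" "wprod (u @ [s]) = w \<otimes> s"
    using u assms by (auto simp: wprod_append)
  have "count_list (refls (u @ [s])) s = Suc (count_list (refls u) s)"
    using u assms by (simp add: count_refls_append m_assoc)
  then consider "odd (count_list (refls u) s)" | "odd (count_list (refls (u @ [s])) s)"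
    by auto
  then show ?thesis
  proof cases
    case 1
    then show ?thesis using odd_refls_shortens[OF u(1), of s] u assms by simp
  next
    case 2
    then show ?thesis
      using odd_refls_shortens[OF us(1), of s] us(2) assms by (simp add: m_assoc)
  qed
qed

section \<open>Factorization along a parabolic subgroup\<close>

text \<open>A second occurrence of \<open>s\<close> would come from \<open>u\<close>, because conjugation by \<open>s\<close> fixes \<open>s\<close>; deleting
  the corresponding letter of \<open>u\<close> would give a word in \<open>I\<close> for \<open>u s\<close> with two letters fewer.\<close>

lemma last_gen_refls_once:
  assumes "I \<subseteq> S" "u @ [s] \<in> lists I"
    and min: "\<And>v. v \<in> lists I \<Longrightarrow> wprod v = wprod (u @ [s]) \<Longrightarrow> length (u @ [s]) \<le> length v"
  shows "count_list (refls (u @ [s])) s = 1"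
proof -
  have S: "u \<in> lists S" "s \<in> S" and uI: "u \<in> lists I"
    using assms by auto
  have "s \<notin> set (refls u)"
  proof
    assume "s \<in> set (refls u)"
    from deletion[OF assms(1) uI this] obtain v where
      "v \<in> lists I" "length u = Suc (length v)" "wprod v = wprod u \<otimes> s" .
    with min[of v] S show False
      by (auto simp: wprod_append)
  qed
  with S show ?thesis
    by (simp add: count_refls_append m_assoc count_notin)
qed

text \<open>Let \<open>s\<close> be the last letter of a shortest word in \<open>I\<close> for \<open>y \<noteq> e\<close>.  The letters of \<open>x\<close> contribute
  \<open>s\<close> to the reflections of \<open>x y\<close> as often as \<open>t = y s y\<inverse> \<in> W\<^sub>I\<close> occurs among the reflections of
  \<open>x\<close>, which is an even number of times since \<open>x t\<close> is not shorter than \<open>x\<close>.  The letters of \<open>y\<close>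
  add one occurrence, so that \<open>x y s\<close> is shorter than \<open>x y\<close>.\<close>

lemma min_rep_of_shortest:
  assumes "I \<subseteq> S" "x \<in> carrier W" "y \<in> parabolic W I"
    and min: "\<And>z. z \<in> parabolic W I \<Longrightarrow> cox_length W S x \<le> cox_length W S (x \<otimes> z)"
    and rep: "x \<otimes> y \<in> min_reps W S I"
  shows "y = \<one>"
proof (rule ccontr)
  assume "y \<noteq> \<one>"
  obtain u0 where "u0 \<in> lists I" "wprod u0 = y"
    using parabolic_word[OF assms(1,3)] .
  then obtain u where u: "u \<in> lists I" "wprod u = y"
    and least: "\<And>v. v \<in> lists I \<Longrightarrow> wprod v = y \<Longrightarrow> length u \<le> length v"
    using ex_has_least_nat[of "\<lambda>u. u \<in> lists I \<and> wprod u = y" u0 length] by blast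
  from u \<open>y \<noteq> \<one>\<close> obtain u' s where u': "u = u' @ [s]"
    by (cases u rule: rev_cases) auto
  have s: "s \<in> I" "s \<in> S" and uS: "u \<in> lists S"
    using u u' assms(1) by auto
  have y: "y \<in> carrier W"
    using assms parabolic_closed by blast
  obtain v where v: "v \<in> lists S" "wprod v = x"
    using reduced_word[OF assms(2)] by metis
  define t where "t = y \<otimes> s \<otimes> inv y"
  have t: "t \<in> parabolic W I"
    using parabolic_subgroup[OF assms(1)] assms(3) s(1) unfolding t_def
    by (intro subgroup.m_closed subgroup.m_inv_closed) (auto intro: generate.incl)
  have "even (count_list (refls v) t)"
    using odd_refls_shortens[OF v(1), of t] min[OF t] parabolic_closed[OF assms(1) t] v(2)
    by (metis not_less)
  moreover have "count_list (refls u) s = 1"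
    using last_gen_refls_once[OF assms(1)] u least unfolding u' by blast
  ultimately have "odd (count_list (refls (v @ u)) s)"
    using v uS s u(2) by (simp add: count_refls_append flip: t_def)
  moreover have "v @ u \<in> lists S" "wprod (v @ u) = x \<otimes> y"
    using v uS u(2) by (auto simp: wprod_append)
  ultimately have "cox_length W S (x \<otimes> y \<otimes> s) < cox_length W S (x \<otimes> y)"
    using odd_refls_shortens[of "v @ u" s] s by simp
  with rep s(1) show False
    by (force simp: min_reps_def)
qed

text \<open>A shortest element of \<open>w W\<^sub>I\<close> is in \<open>X\<^sub>I\<close>, as multiplication by a generator never preserves the
  length, and any other element of \<open>X\<^sub>I\<close> in this coset is compared with it.\<close>

lemma min_reps_factorization:
  assumes "I \<subseteq> S" "w \<in> carrier W"
  shows "\<exists>!x. x \<in> min_reps W S I \<and> (\<exists>y\<in>parabolic W I. w = x \<otimes> y)"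
proof -
  note sub = parabolic_subgroup[OF assms(1)]
  note closed = parabolic_closed[OF assms(1)]
  obtain y0 where y0: "y0 \<in> parabolic W I"
    and least: "\<And>y. y \<in> parabolic W I \<Longrightarrow> cox_length W S (w \<otimes> y0) \<le> cox_length W S (w \<otimes> y)"
    using ex_has_least_nat[of "\<lambda>y. y \<in> parabolic W I" \<one> "\<lambda>y. cox_length W S (w \<otimes> y)"]
      generate.one by blast
  define x where "x = w \<otimes> y0"
  have x: "x \<in> carrier W"
    using assms y0 closed by (simp add: x_def)
  have min: "cox_length W S x \<le> cox_length W S (x \<otimes> z)" if "z \<in> parabolic W I" for z
    using least[OF subgroup.m_closed[OF sub y0 that]] assms y0 that closed
    by (simp add: x_def m_assoc)
  have coset: "w = x \<otimes> inv y0"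
    using assms y0 closed by (simp add: x_def m_assoc)
  have "cox_length W S x < cox_length W S (x \<otimes> s)" if "s \<in> I" for s
    using min[OF generate.incl[OF that]] cox_length_mult_gen_neq[OF x, of s] that assms(1)
    by fastforce
  then have "x \<in> min_reps W S I"
    using x by (auto simp: min_reps_def)
  moreover have "x' = x" if "x' \<in> min_reps W S I" "y \<in> parabolic W I" "w = x' \<otimes> y" for x' y
  proof -
    have c: "x' \<in> carrier W" "y \<in> carrier W" "y0 \<in> carrier W"
      using that y0 closed by (auto simp: min_reps_def)
    have "x' = w \<otimes> inv y"
      using c that(3) by (simp add: m_assoc)
    then have eq: "x' = x \<otimes> (inv y0 \<otimes> inv y)"
      using c x by (simp add: coset m_assoc)
    have "inv y0 \<otimes> inv y \<in> parabolic W I"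
      using sub y0 that(2) by (simp add: subgroup.m_closed subgroup.m_inv_closed)
    from min_rep_of_shortest[OF assms(1) x this min] that(1) eq show ?thesis
      using x by simp
  qed
  ultimately show ?thesis
    using coset subgroup.m_inv_closed[OF sub y0] by blast
qed

lemma upper_part_mult:
  assumes "I \<subseteq> S" "x \<in> min_reps W S I" "y \<in> parabolic W I"
  shows "upper_part W S I (x \<otimes> y) = x"
proof -
  have "x \<otimes> y \<in> carrier W"
    using assms parabolic_closed by (auto simp: min_reps_def)
  from min_reps_factorization[OF assms(1) this] show ?thesis
    unfolding upper_part_def using assms(2,3) by (intro the1_equality) blast+
qed

lemma lower_part_mult:
  assumes "I \<subseteq> S" "x \<in> min_reps W S I" "y \<in> parabolic W I"
  shows "lower_part W S I (x \<otimes> y) = y"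
  unfolding lower_part_def
proof (rule the_equality)
  show "y \<in> parabolic W I \<and> (\<exists>x'\<in>min_reps W S I. x \<otimes> y = x' \<otimes> y)"
    using assms by blast
next
  fix y' assume y': "y' \<in> parabolic W I \<and> (\<exists>x'\<in>min_reps W S I. x \<otimes> y = x' \<otimes> y')"
  then obtain x' where x': "x' \<in> min_reps W S I" "x \<otimes> y = x' \<otimes> y'" by blast
  then have "x' = x"
    using upper_part_mult assms y' by metis
  then show "y' = y"
    using x' y' assms parabolic_closed by (auto simp: min_reps_def)
qed

lemma factorize:
  assumes "I \<subseteq> S" "w \<in> carrier W"
  obtains x y where "x \<in> min_reps W S I" "y \<in> parabolic W I" "w = x \<otimes> y"
  using min_reps_factorization[OF assms] by blast

lemma cox_length_one: "cox_length W S \<one> = 0"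
  using cox_length_le[of "[]"] by simp

lemma one_min_reps:
  assumes "I \<subseteq> S"
  shows "\<one> \<in> min_reps W S I"
proof -
  have "cox_length W S (\<one> \<otimes> s) > cox_length W S \<one>" if "s \<in> I" for s
    using cox_length_mult_gen_neq[of \<one> s] that assms cox_length_one by auto
  then show ?thesis by (simp add: min_reps_def)
qed

lemma min_reps_empty: "min_reps W S {} = carrier W"
  by (auto simp: min_reps_def)

text \<open>Both \<open>e\<close> and \<open>x\<close> represent the only coset of \<open>W\<^sub>S = W\<close>.\<close>

lemma min_reps_S: "min_reps W S S = {\<one>}"
proof -
  have "x = \<one>" if "x \<in> min_reps W S S" for x
  proof -
    have x: "x \<in> carrier W" using that by (simp add: min_reps_def)
    have "upper_part W S S (x \<otimes> \<one>) = x"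
      by (rule upper_part_mult) (use that in \<open>auto intro: generate.one\<close>)
    moreover have "upper_part W S S (\<one> \<otimes> x) = \<one>"
      by (rule upper_part_mult) (use x in \<open>auto intro: one_min_reps simp: parabolic_S\<close>)
    ultimately show ?thesis using x by simp
  qed
  with one_min_reps[of S] show ?thesis by blast
qed

section \<open>The extreme cases\<close>

lemma upper_part_empty: "w \<in> carrier W \<Longrightarrow> upper_part W S {} w = w"
  using upper_part_mult[of "{}" w \<one>] by (simp add: min_reps_empty generate.one)

lemma lower_part_empty: "w \<in> carrier W \<Longrightarrow> lower_part W S {} w = \<one>"
  using lower_part_mult[of "{}" w \<one>] by (simp add: min_reps_empty generate.one)

lemma upper_part_S: "w \<in> carrier W \<Longrightarrow> upper_part W S S w = \<one>"
  using upper_part_mult[of S \<one> w] by (simp add: min_reps_S parabolic_S)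

lemma lower_part_S: "w \<in> carrier W \<Longrightarrow> lower_part W S S w = w"
  using lower_part_mult[of S \<one> w] by (simp add: min_reps_S parabolic_S)

lemma lower_part_eq_self_iff:
  assumes "I \<subseteq> S" "w \<in> carrier W"
  shows "w = lower_part W S I w \<longleftrightarrow> w \<in> parabolic W I"
proof
  assume "w \<in> parabolic W I"
  with lower_part_mult[OF assms(1) one_min_reps[OF assms(1)]] assms(2)
  show "w = lower_part W S I w" by fastforce
next
  assume "w = lower_part W S I w"
  then show "w \<in> parabolic W I"
    using factorize[OF assms] lower_part_mult[OF assms(1)] by metis
qed

lemma lower_part_eq_one_iff:
  assumes "I \<subseteq> S" "w \<in> carrier W"
  shows "lower_part W S I w = \<one> \<longleftrightarrow> w \<in> min_reps W S I"
proof -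
  obtain x y where xy: "x \<in> min_reps W S I" "y \<in> parabolic W I" "w = x \<otimes> y"
    using factorize[OF assms] .
  have x: "x \<in> carrier W"
    using xy(1) by (simp add: min_reps_def)
  show ?thesis
  proof
    assume "lower_part W S I w = \<one>"
    then have "y = \<one>"
      using lower_part_mult[OF assms(1) xy(1,2)] xy(3) by simp
    then show "w \<in> min_reps W S I"
      using xy x by simp
  next
    assume "w \<in> min_reps W S I"
    from lower_part_mult[OF assms(1) this generate.one] assms(2)
    show "lower_part W S I w = \<one>" by simp
  qed
qed

lemma upper_part_eq_iff:
  assumes "I \<subseteq> S" "c \<in> min_reps W S I" "w \<in> carrier W"
  shows "upper_part W S I w = c \<longleftrightarrow> (\<exists>y\<in>parabolic W I. w = c \<otimes> y)"
  using factorize[OF assms(1,3)] upper_part_mult[OF assms(1)] assms(2) by metis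

lemma W_set_right_empty:
  assumes "I \<subseteq> S" "b \<in> carrier W"
  shows "W_set W S I {} b = (\<lambda>y. y \<otimes> b) ` parabolic W I"
proof -
  have "W_set W S I {} b = {w \<in> carrier W. w \<otimes> inv b \<in> parabolic W I}"
    using assms by (auto simp: W_set_def upper_part_empty lower_part_eq_self_iff)
  also have "\<dots> = (\<lambda>y. y \<otimes> b) ` parabolic W I"
  proof (intro equalityI subsetI)
    fix w assume "w \<in> {w \<in> carrier W. w \<otimes> inv b \<in> parabolic W I}"
    then show "w \<in> (\<lambda>y. y \<otimes> b) ` parabolic W I"
      using assms(2) by (intro image_eqI[of _ _ "w \<otimes> inv b"]) (auto simp: m_assoc)
  qed (use assms parabolic_closed in \<open>auto simp: m_assoc\<close>)
  finally show ?thesis .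
qed

lemma W_set_left_empty:
  assumes "I \<subseteq> S" "c \<in> min_reps W S I"
  shows "W_set W S {} I c = (\<lambda>y. c \<otimes> y) ` parabolic W I"
proof -
  have c: "c \<in> carrier W"
    using assms(2) by (simp add: min_reps_def)
  have "upper_part W S I w \<otimes> inv c = \<one> \<longleftrightarrow> upper_part W S I w = c" if "w \<in> carrier W" for w
  proof -
    have "upper_part W S I w \<in> carrier W"
      using factorize[OF assms(1) that] upper_part_mult[OF assms(1)]
      by (metis (no_types, lifting) min_reps_def mem_Collect_eq)
    with c show ?thesis
      by (metis inv_closed inv_equality inv_inv r_inv)
  qed
  with c have "W_set W S {} I c = {w \<in> carrier W. \<exists>y\<in>parabolic W I. w = c \<otimes> y}"
    by (auto simp: W_set_def lower_part_empty upper_part_eq_iff[OF assms])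
  then show ?thesis
    using c parabolic_closed[OF assms(1)] by auto
qed

lemma W_set_right_S:
  assumes "I \<subseteq> S"
  shows "W_set W S I S \<one> = min_reps W S I"
proof -
  have "W_set W S I S \<one> = {w \<in> carrier W. lower_part W S I w = \<one>}"
    by (auto simp: W_set_def upper_part_S)
  with assms show ?thesis
    by (auto simp: lower_part_eq_one_iff min_reps_def)
qed

lemma W_set_left_S:
  assumes "I \<subseteq> S"
  shows "W_set W S S I \<one> = min_reps W S I"
proof -
  have "upper_part W S I w \<otimes> \<one> = w \<longleftrightarrow> w \<in> min_reps W S I" if w: "w \<in> carrier W" for w
  proof -
    obtain x y where xy: "x \<in> min_reps W S I" "y \<in> parabolic W I" "w = x \<otimes> y"
      using factorize[OF assms w] .
    have "upper_part W S I w = x" and "x \<in> carrier W"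
      using upper_part_mult[OF assms] xy by (auto simp: min_reps_def)
    moreover have "w = x" if "w \<in> min_reps W S I"
      using upper_part_mult[OF assms that generate.one] calculation w by simp
    ultimately show ?thesis using xy(1) by auto
  qed
  then show ?thesis
    by (auto simp: W_set_def lower_part_S min_reps_def)
qed

end

theorem proposition4p14:
  fixes W :: "('a, 'b) monoid_scheme" and S I :: "'a set"
  assumes "coxeter_system W S" and "finite (carrier W)" and "I \<subseteq> S"
  shows "(\<forall>b \<in> double_reps W S I {}.
            card (W_set W S I {} b) = card (parabolic W I) \<and>
            card (W_set W S {} I (inv\<^bsub>W\<^esub> b)) = card (parabolic W I)) \<and>
         double_reps W S I S = {\<one>\<^bsub>W\<^esub>} \<and>
         W_set W S I S \<one>\<^bsub>W\<^esub> = min_reps W S I \<and>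
         W_set W S S I \<one>\<^bsub>W\<^esub> = min_reps W S I"
proof -
  obtain m where m: "coxeter_matrix S m" "has_presentation W S (coxeter_relators S m)"
    using assms(1) by (auto simp: coxeter_system_def)
  interpret group W
    using m(2) by (simp add: has_presentation_def)
  interpret coxeter_group W S m
    by unfold_locales (fact m)+
  note closed = parabolic_closed[OF assms(3)]
  have "card (W_set W S I {} b) = card (parabolic W I) \<and>
      card (W_set W S {} I (inv\<^bsub>W\<^esub> b)) = card (parabolic W I)"
    if "b \<in> double_reps W S I {}" for b
  proof -
    from that obtain x where x: "x \<in> min_reps W S I" "b = inv\<^bsub>W\<^esub> x"
      by (auto simp: double_reps_def)
    then have c: "x \<in> carrier W" "b \<in> carrier W" "inv\<^bsub>W\<^esub> b = x"
      by (auto simp: min_reps_def)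
    have "inj_on (\<lambda>y. y \<otimes>\<^bsub>W\<^esub> b) (parabolic W I)" "inj_on (\<lambda>y. x \<otimes>\<^bsub>W\<^esub> y) (parabolic W I)"
      using c closed by (auto intro!: inj_onI)
    then show ?thesis
      using c x(1) assms(3) by (simp add: W_set_right_empty W_set_left_empty card_image)
  qed
  moreover have "double_reps W S I S = {\<one>\<^bsub>W\<^esub>}"
    using one_min_reps[OF assms(3)] by (force simp: double_reps_def min_reps_S)
  ultimately show ?thesis
    using W_set_right_S W_set_left_S assms(3) by blast
qed

end
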